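(* There is an algorithm which takes as input an instance $G$ of \textsc{Stable Matching}, runs in time linear in the size of the input, and outputs a collection of pairwise edge-disjoint stable matchings of $G$ of the largest possible size (i.e., no collection of pairwise edge-disjoint stable matchings of $G$ has more members).
   Context: An instance of \textsc{Stable Matching} consists of a complete bipartite graph $G$ with vertex partition $V(G)=\mathcal{M}\uplus\mathcal{W}$ (the "men" and the "women", with $|\mathcal{M}|=|\mathcal{W}|=n$), where each woman has a strictly ordered preference list containing all the men and each man has a strictly ordered preference list containing all the women (earlier in the list means more preferred). For a perfect matching $M$ and a person $x$, let $p_M(x)$ denote the partner of $x$ in $M$. A man-woman pair $(m,w)$ blocks a perfect matching $M$ if $w$ prefers $m$ to $p_M(w)$ and $m$ prefers $w$ to $p_M(m)$. A perfect matching is stable if no pair blocks it. Matchings are pairwise disjoint if no two of them share an edge. The input size is the size of $G$ together with the preference lists. *)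

theory Defs
  imports Main
begin

section \<open>Stable matching\<close>

text \<open>The men and the women are each numbered from 0 to n - 1; the m-th entry of \<open>mprefs\<close> is the
  preference list of man m, most preferred woman first, and likewise for \<open>wprefs\<close>.\<close>

record sm =
  num :: nat
  mprefs :: "nat list list"
  wprefs :: "nat list list"

definition men :: "sm \<Rightarrow> nat set" where
  "men I = {..<num I}"

definition women :: "sm \<Rightarrow> nat set" where
  "women I = {..<num I}"

definition sm_instance :: "sm \<Rightarrow> bool" where
  "sm_instance I \<longleftrightarrow>
     length (mprefs I) = num I \<and> length (wprefs I) = num I \<and>
     (\<forall>m\<in>men I. distinct (mprefs I ! m) \<and> set (mprefs I ! m) = women I) \<and>
     (\<forall>w\<in>women I. distinct (wprefs I ! w) \<and> set (wprefs I ! w) = men I)"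

definition prefers :: "nat list \<Rightarrow> nat \<Rightarrow> nat \<Rightarrow> bool" where
  "prefers xs x y \<longleftrightarrow> (\<exists>i j. i < j \<and> j < length xs \<and> xs ! i = x \<and> xs ! j = y)"

text \<open>An edge is a pair (man, woman), so a matching is a set of such pairs.\<close>

definition perfect_matching :: "sm \<Rightarrow> (nat \<times> nat) set \<Rightarrow> bool" where
  "perfect_matching I M \<longleftrightarrow>
     M \<subseteq> men I \<times> women I \<and>
     (\<forall>m\<in>men I. \<exists>!w. (m, w) \<in> M) \<and>
     (\<forall>w\<in>women I. \<exists>!m. (m, w) \<in> M)"

definition partner_of_man :: "(nat \<times> nat) set \<Rightarrow> nat \<Rightarrow> nat" where
  "partner_of_man M m = (THE w. (m, w) \<in> M)"

definition partner_of_woman :: "(nat \<times> nat) set \<Rightarrow> nat \<Rightarrow> nat" where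
  "partner_of_woman M w = (THE m. (m, w) \<in> M)"

definition blocks :: "sm \<Rightarrow> nat \<Rightarrow> nat \<Rightarrow> (nat \<times> nat) set \<Rightarrow> bool" where
  "blocks I m w M \<longleftrightarrow>
     prefers (wprefs I ! w) m (partner_of_woman M w) \<and>
     prefers (mprefs I ! m) w (partner_of_man M m)"

definition stable_matching :: "sm \<Rightarrow> (nat \<times> nat) set \<Rightarrow> bool" where
  "stable_matching I M \<longleftrightarrow>
     perfect_matching I M \<and> \<not> (\<exists>m\<in>men I. \<exists>w\<in>women I. blocks I m w M)"

definition disjoint_stable_matchings :: "sm \<Rightarrow> (nat \<times> nat) set set \<Rightarrow> bool" where
  "disjoint_stable_matchings I C \<longleftrightarrow> (\<forall>M\<in>C. stable_matching I M) \<and> pairwise disjnt C"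

text \<open>Every such collection is finite, because its members are subsets of the finite set
  \<open>men I \<times> women I\<close>; hence \<open>card\<close> is the actual number of members.\<close>

definition largest_disjoint_stable_matchings :: "sm \<Rightarrow> (nat \<times> nat) set set \<Rightarrow> bool" where
  "largest_disjoint_stable_matchings I C \<longleftrightarrow>
     disjoint_stable_matchings I C \<and>
     (\<forall>C'. disjoint_stable_matchings I C' \<longrightarrow> card C' \<le> card C)"

text \<open>Vertices and edges of the complete bipartite graph, and entries of the preference lists.\<close>

definition input_size :: "sm \<Rightarrow> nat" where
  "input_size I = card (men I) + card (women I) + card (men I \<times> women I)
     + (\<Sum>xs\<leftarrow>mprefs I. length xs) + (\<Sum>xs\<leftarrow>wprefs I. length xs)"


section \<open>Word RAM programs\<close>

text \<open>Algorithms are programs of a structured word RAM. Its memory consists of named registers and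
  named arrays; every program mentions only finitely many names. Each operator, memory access,
  assignment and test costs one step. Subtraction is truncated.

  The parameter \<open>W\<close> is the number of values of a machine word: execution is stuck as soon as some
  (sub)expression, including an array index, takes a value \<open>\<ge> W\<close>, so that unit-cost arithmetic never
  acts on numbers longer than one machine word.\<close>

record ram_state =
  reg :: "string \<Rightarrow> nat"
  mem :: "string \<Rightarrow> nat \<Rightarrow> nat"

datatype aexp =
    Const nat
  | Reg string
  | Get string aexp
  | Plus aexp aexp
  | Minus aexp aexp
  | Times aexp aexp

datatype bexp =
    Less aexp aexp
  | Equal aexp aexp
  | Not bexp
  | And bexp bexp

datatype com =
    Skip
  | Assign string aexp
  | Put string aexp aexp
  | Seq com com
  | If bexp com com
  | While bexp com

fun aval :: "aexp \<Rightarrow> ram_state \<Rightarrow> nat" where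
  "aval (Const k) s = k"
| "aval (Reg x) s = reg s x"
| "aval (Get a e) s = mem s a (aval e s)"
| "aval (Plus e f) s = aval e s + aval f s"
| "aval (Minus e f) s = aval e s - aval f s"
| "aval (Times e f) s = aval e s * aval f s"

fun bval :: "bexp \<Rightarrow> ram_state \<Rightarrow> bool" where
  "bval (Less e f) s = (aval e s < aval f s)"
| "bval (Equal e f) s = (aval e s = aval f s)"
| "bval (Not b) s = (\<not> bval b s)"
| "bval (And b c) s = (bval b s \<and> bval c s)"

fun asubs :: "aexp \<Rightarrow> aexp set" where
  "asubs (Const k) = {Const k}"
| "asubs (Reg x) = {Reg x}"
| "asubs (Get a e) = insert (Get a e) (asubs e)"
| "asubs (Plus e f) = insert (Plus e f) (asubs e \<union> asubs f)"
| "asubs (Minus e f) = insert (Minus e f) (asubs e \<union> asubs f)"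
| "asubs (Times e f) = insert (Times e f) (asubs e \<union> asubs f)"

fun bsubs :: "bexp \<Rightarrow> aexp set" where
  "bsubs (Less e f) = asubs e \<union> asubs f"
| "bsubs (Equal e f) = asubs e \<union> asubs f"
| "bsubs (Not b) = bsubs b"
| "bsubs (And b c) = bsubs b \<union> bsubs c"

definition fits :: "nat \<Rightarrow> aexp set \<Rightarrow> ram_state \<Rightarrow> bool" where
  "fits W E s \<longleftrightarrow> (\<forall>e\<in>E. aval e s < W)"

fun acost :: "aexp \<Rightarrow> nat" where
  "acost (Const k) = 1"
| "acost (Reg x) = 1"
| "acost (Get a e) = 1 + acost e"
| "acost (Plus e f) = 1 + acost e + acost f"
| "acost (Minus e f) = 1 + acost e + acost f"
| "acost (Times e f) = 1 + acost e + acost f"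

fun bcost :: "bexp \<Rightarrow> nat" where
  "bcost (Less e f) = 1 + acost e + acost f"
| "bcost (Equal e f) = 1 + acost e + acost f"
| "bcost (Not b) = 1 + bcost b"
| "bcost (And b c) = 1 + bcost b + bcost c"

definition set_reg :: "string \<Rightarrow> nat \<Rightarrow> ram_state \<Rightarrow> ram_state" where
  "set_reg x v s = s\<lparr>reg := (reg s)(x := v)\<rparr>"

definition set_mem :: "string \<Rightarrow> nat \<Rightarrow> nat \<Rightarrow> ram_state \<Rightarrow> ram_state" where
  "set_mem a i v s = s\<lparr>mem := (mem s)(a := (mem s a)(i := v))\<rparr>"

text \<open>\<open>exec W p s t s'\<close>: on a machine with \<open>W\<close> word values, \<open>p\<close> started in \<open>s\<close> halts in \<open>s'\<close> after
  exactly \<open>t\<close> steps.\<close>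

inductive exec :: "nat \<Rightarrow> com \<Rightarrow> ram_state \<Rightarrow> nat \<Rightarrow> ram_state \<Rightarrow> bool" for W :: nat where
  Skip: "exec W Skip s 1 s"
| Assign: "fits W (asubs e) s \<Longrightarrow>
    exec W (Assign x e) s (1 + acost e) (set_reg x (aval e s) s)"
| Put: "fits W (asubs i \<union> asubs e) s \<Longrightarrow>
    exec W (Put a i e) s (1 + acost i + acost e) (set_mem a (aval i s) (aval e s) s)"
| Seq: "exec W p s t s' \<Longrightarrow> exec W q s' u s'' \<Longrightarrow> exec W (Seq p q) s (t + u) s''"
| IfTrue: "fits W (bsubs b) s \<Longrightarrow> bval b s \<Longrightarrow> exec W p s t s' \<Longrightarrow>
    exec W (If b p q) s (1 + bcost b + t) s'"
| IfFalse: "fits W (bsubs b) s \<Longrightarrow> \<not> bval b s \<Longrightarrow> exec W q s t s' \<Longrightarrow>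
    exec W (If b p q) s (1 + bcost b + t) s'"
| WhileTrue: "fits W (bsubs b) s \<Longrightarrow> bval b s \<Longrightarrow> exec W p s t s' \<Longrightarrow>
    exec W (While b p) s' u s'' \<Longrightarrow> exec W (While b p) s (1 + bcost b + t + u) s''"
| WhileFalse: "fits W (bsubs b) s \<Longrightarrow> \<not> bval b s \<Longrightarrow> exec W (While b p) s (1 + bcost b) s"

inductive_cases SkipE: "exec W Skip s t s'"
inductive_cases AssignE: "exec W (Assign x e) s t s'"
inductive_cases PutE: "exec W (Put a i e) s t s'"
inductive_cases SeqE: "exec W (Seq p q) s t s'"
inductive_cases IfE: "exec W (If b p q) s t s'"
inductive_cases WhileE: "exec W (While b p) s t s'"

lemma exec_deterministic:
  "exec W p s t s' \<Longrightarrow> exec W p s u s'' \<Longrightarrow> u = t \<and> s'' = s'"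
proof (induction arbitrary: u s'' rule: exec.induct)
  case (Seq p s t s' q v r)
  from Seq.prems show ?case by (rule SeqE) (metis Seq.IH)
next
  case (WhileTrue b s p t s' v r)
  from WhileTrue.prems show ?case
    by (rule WhileE) (use WhileTrue.hyps in \<open>auto dest!: WhileTrue.IH\<close>)
next
  case (IfTrue b s p t s' q)
  from IfTrue.prems show ?case
    by (rule IfE) (use IfTrue.hyps in \<open>auto dest!: IfTrue.IH\<close>)
next
  case (IfFalse b s q t s' p)
  from IfFalse.prems show ?case
    by (rule IfE) (use IfFalse.hyps in \<open>auto dest!: IfFalse.IH\<close>)
next
  case (WhileFalse b s p)
  from WhileFalse.prems show ?case by (rule WhileE) (use WhileFalse.hyps in auto)
qed (erule SkipE AssignE PutE, simp)+


section \<open>Input and output conventions\<close>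

text \<open>The preference lists of each side are stored row by row: entry j of the list of person i is
  in cell i * n + j. All other memory is initially 0.\<close>

definition rows :: "nat \<Rightarrow> nat list list \<Rightarrow> nat \<Rightarrow> nat" where
  "rows n xss i = (if i < n * n then xss ! (i div n) ! (i mod n) else 0)"

definition initial_state :: "sm \<Rightarrow> ram_state" where
  "initial_state I =
     \<lparr>reg = (\<lambda>_. 0)(''n'' := num I),
      mem = (\<lambda>_ _. 0)(''mprefs'' := rows (num I) (mprefs I), ''wprefs'' := rows (num I) (wprefs I))\<rparr>"

text \<open>The output is a list of matchings; its length is in register \<open>count\<close>, and the partner of
  man m in the i-th matching is in cell i * n + m of the array \<open>out\<close>.\<close>

definition output_matchings :: "sm \<Rightarrow> ram_state \<Rightarrow> (nat \<times> nat) set list" where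
  "output_matchings I s =
     map (\<lambda>i. {(m, w). m \<in> men I \<and> w = mem s ''out'' (i * num I + m)}) [0..<reg s ''count'']"

end

theory Submission
  imports Defs
begin

text \<open>Run deferred acceptance in rounds. When a round ends with a perfect matching, that matching is
  output, all men are released, and every man continues with the next woman on his list, while every
  woman keeps rejecting all men who are not better than the best proposer she has ever had. Each
  round yields a stable matching, and no man ever proposes twice to the same woman, so the
  matchings are disjoint and the total number of proposals is at most the square of n.

  For optimality, let C be any family of disjoint stable matchings. In the round with number r
  (from 0), no man's list pointer has passed his partners in more than r members of C. Suppose w rejects
  b in favour of a. If (b, w) lies in no member of C, then b's pointer passes no further partner.
  Otherwise every member in which b's partner is w or better for b has a's partner strictly before w
  on a's list: if not, w does at least as well as a in that member, hence strictly better than b, and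
  since (b, w) is a pair of some stable matching, b does strictly worse than w there. So b has
  passed at most as many members as a had before proposing to w, that is, at most r. A man who
  exhausts his list has passed all members, so C has at most r members.\<close>

section \<open>Preference orders and partners in perfect matchings\<close>

lemma prefers_nth_iff:
  assumes "distinct xs" "i < length xs" "j < length xs"
  shows "prefers xs (xs ! i) (xs ! j) \<longleftrightarrow> i < j"
  unfolding prefers_def using assms by (metis dual_order.strict_trans nth_eq_iff_index_eq)

lemma prefers_linear:
  assumes "x \<in> set xs" "y \<in> set xs" "x \<noteq> y"
  shows "prefers xs x y \<or> prefers xs y x"
  using assms unfolding prefers_def in_set_conv_nth by (metis nat_neq_iff)

lemma prefers_asym: "distinct xs \<Longrightarrow> prefers xs x y \<Longrightarrow> \<not> prefers xs y x"
  unfolding prefers_def by (metis nth_eq_iff_index_eq order.asym order.strict_trans)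

lemma prefers_irrefl: "distinct xs \<Longrightarrow> \<not> prefers xs x x"
  using prefers_asym by metis

lemma partner_of_man_eq: "perfect_matching I N \<Longrightarrow> (m, w) \<in> N \<Longrightarrow> partner_of_man N m = w"
  unfolding perfect_matching_def partner_of_man_def by (metis (no_types, lifting) mem_Sigma_iff subset_iff the1_equality)

lemma partner_of_woman_eq: "perfect_matching I N \<Longrightarrow> (m, w) \<in> N \<Longrightarrow> partner_of_woman N w = m"
  unfolding perfect_matching_def partner_of_woman_def by (metis (no_types, lifting) mem_Sigma_iff subset_iff the1_equality)

lemma partner_of_man_in: "perfect_matching I N \<Longrightarrow> m \<in> men I \<Longrightarrow> (m, partner_of_man N m) \<in> N"
  unfolding perfect_matching_def partner_of_man_def by (metis (no_types, lifting) theI')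

lemma partner_of_woman_in: "perfect_matching I N \<Longrightarrow> w \<in> women I \<Longrightarrow> (partner_of_woman N w, w) \<in> N"
  unfolding perfect_matching_def partner_of_woman_def by (metis (no_types, lifting) theI')

lemma perfect_matching_edge: "perfect_matching I N \<Longrightarrow> (m, w) \<in> N \<Longrightarrow> m < num I \<and> w < num I"
  unfolding perfect_matching_def men_def women_def by auto

text \<open>In a perfect matching everyone lies on exactly one edge, so a blocking pair can be read
  off two edges. This form avoids the descriptions \<open>THE\<close> in the partner
  functions.\<close>

lemma stable_matching_iff:
  "stable_matching I N \<longleftrightarrow> perfect_matching I N \<and>
     (\<forall>a w' b w. (a, w') \<in> N \<longrightarrow> (b, w) \<in> N \<longrightarrow>
        \<not> (prefers (wprefs I ! w) a b \<and> prefers (mprefs I ! a) w w'))"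
proof (cases "perfect_matching I N")
  case True
  note p = partner_of_man_eq[OF True] partner_of_woman_eq[OF True]
    partner_of_man_in[OF True] partner_of_woman_in[OF True]
  have e: "a \<in> men I \<and> w \<in> women I" if "(a, w) \<in> N" for a w
    using True that unfolding perfect_matching_def by auto
  show ?thesis
    unfolding stable_matching_def blocks_def using True p e by metis
qed (simp add: stable_matching_def)

section \<open>Stable matchings and families of disjoint stable matchings\<close>

locale stable_marriage =
  fixes I :: sm
  assumes valid: "sm_instance I"
begin

abbreviation n :: nat where "n \<equiv> num I"

definition choice :: "nat \<Rightarrow> nat \<Rightarrow> nat" where
  "choice a j = mprefs I ! a ! j"

text \<open>Larger scores are better, and the score of every man is positive, so that 0 can stand for
  ``no proposal received''.\<close>

definition score :: "nat \<Rightarrow> nat \<Rightarrow> nat" where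
  "score w a = n - (LEAST j. wprefs I ! w ! j = a)"

lemma mprefs: "a < n \<Longrightarrow> distinct (mprefs I ! a)" "a < n \<Longrightarrow> set (mprefs I ! a) = {..<n}"
  using valid unfolding sm_instance_def men_def women_def by auto

lemma wprefs: "w < n \<Longrightarrow> distinct (wprefs I ! w)" "w < n \<Longrightarrow> set (wprefs I ! w) = {..<n}"
  using valid unfolding sm_instance_def men_def women_def by auto

lemma length_mprefs: "a < n \<Longrightarrow> length (mprefs I ! a) = n"
  using mprefs distinct_card by (metis card_lessThan)

lemma length_wprefs: "w < n \<Longrightarrow> length (wprefs I ! w) = n"
  using wprefs distinct_card by (metis card_lessThan)

lemma choice_less: "a < n \<Longrightarrow> j < n \<Longrightarrow> choice a j < n"
  unfolding choice_def using mprefs(2) length_mprefs nth_mem by (metis lessThan_iff)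

lemma choice_eq_iff: "a < n \<Longrightarrow> i < n \<Longrightarrow> j < n \<Longrightarrow> choice a i = choice a j \<longleftrightarrow> i = j"
  unfolding choice_def using mprefs(1) length_mprefs by (simp add: nth_eq_iff_index_eq)

lemma choice_surj: "a < n \<Longrightarrow> w < n \<Longrightarrow> \<exists>j<n. choice a j = w"
  unfolding choice_def using mprefs(2) length_mprefs by (metis in_set_conv_nth lessThan_iff)

lemma prefers_choice_iff:
  "a < n \<Longrightarrow> i < n \<Longrightarrow> j < n \<Longrightarrow> prefers (mprefs I ! a) (choice a i) (choice a j) \<longleftrightarrow> i < j"
  unfolding choice_def using mprefs(1) length_mprefs by (simp add: prefers_nth_iff)

lemma score_nth: "w < n \<Longrightarrow> j < n \<Longrightarrow> score w (wprefs I ! w ! j) = n - j"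
  unfolding score_def using wprefs(1) length_wprefs
  by (subst Least_equality) (auto, metis nle_le nth_eq_iff_index_eq order.strict_trans1)

lemma score_pos: "w < n \<Longrightarrow> a < n \<Longrightarrow> 0 < score w a"
  using score_nth wprefs(2) length_wprefs by (metis in_set_conv_nth lessThan_iff zero_less_diff)

lemma score_le: "score w a \<le> n"
  unfolding score_def by simp

lemma prefers_score_iff:
  assumes "w < n" "a < n" "b < n"
  shows "prefers (wprefs I ! w) a b \<longleftrightarrow> score w b < score w a"
proof -
  obtain i j where ij: "i < n" "j < n" "a = wprefs I ! w ! i" "b = wprefs I ! w ! j"
    using assms wprefs(2) length_wprefs by (metis in_set_conv_nth lessThan_iff)
  then show ?thesis
    using assms score_nth prefers_nth_iff wprefs(1) length_wprefs by auto
qed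

lemma score_eq_iff:
  assumes "w < n" "a < n" "b < n"
  shows "score w a = score w b \<longleftrightarrow> a = b"
  using prefers_score_iff[OF assms] prefers_score_iff[of w b a] assms
    prefers_linear[of a "wprefs I ! w" b] wprefs(2) by auto

text \<open>Otherwise \<open>a\<close> would gain from moving to \<open>N'\<close>, and by the
  counting below he would be the \<open>N\<close>-partner of a woman who loses from that move; that
  woman is \<open>w\<close>, who gains.\<close>

lemma opposition_of_interests:
  assumes N: "stable_matching I N" and N': "stable_matching I N'"
    and aw: "(a, w) \<in> N" "(b, w) \<in> N'" "(a, w') \<in> N'"
    and better: "prefers (wprefs I ! w) b a"
  shows "prefers (mprefs I ! a) w w'"
proof (rule ccontr)
  assume no: "\<not> ?thesis"
  have P: "perfect_matching I N" "perfect_matching I N'"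
    using N N' unfolding stable_matching_iff by auto
  txt \<open>\<open>N'\<close> maps \<open>A\<close> injectively into \<open>B\<close> and \<open>N\<close> maps \<open>B\<close> injectively into \<open>A\<close>; by counting, the
    second map is onto.\<close>
  define A where "A = {a \<in> men I. prefers (mprefs I ! a) (partner_of_man N' a) (partner_of_man N a)}"
  define B where "B = {w \<in> women I. prefers (wprefs I ! w) (partner_of_woman N w) (partner_of_woman N' w)}"
  have fin: "finite A" "finite B" unfolding A_def B_def men_def women_def by auto
  have A_to_B: "partner_of_man N' ` A \<subseteq> B"
  proof
    fix v assume "v \<in> partner_of_man N' ` A"
    then obtain c where c: "c \<in> A" "v = partner_of_man N' c" by auto
    have cv: "(c, v) \<in> N'" "c \<in> men I" using c P partner_of_man_in unfolding A_def by auto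
    have v: "v \<in> women I" "v < n" "c < n"
      using cv P(2) perfect_matching_edge unfolding women_def by auto
    obtain d where d: "(d, v) \<in> N" using partner_of_woman_in P(1) v by blast
    have d': "d < n" using d P(1) perfect_matching_edge by blast
    have pc: "prefers (mprefs I ! c) v (partner_of_man N c)" using c unfolding A_def by auto
    \<comment> \<open>Otherwise \<open>(c, v)\<close> would block \<open>N\<close>.\<close>
    have "\<not> prefers (wprefs I ! v) c d"
      using N d pc partner_of_man_in[OF P(1) cv(2)] unfolding stable_matching_iff by blast
    moreover have "c \<noteq> d"
      using pc d partner_of_man_eq P(1) prefers_irrefl mprefs(1) v(3) by metis
    ultimately have "prefers (wprefs I ! v) d c"
      using prefers_linear[of c _ d] wprefs(2) v d' by auto
    then show "v \<in> B" unfolding B_def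
      using v d cv P partner_of_woman_eq by (metis (mono_tags, lifting) mem_Collect_eq)
  qed
  have B_to_A: "partner_of_woman N ` B \<subseteq> A"
  proof
    fix c assume "c \<in> partner_of_woman N ` B"
    then obtain v where v: "v \<in> B" "c = partner_of_woman N v" by auto
    have cv: "(c, v) \<in> N" "v \<in> women I" using v P partner_of_woman_in unfolding B_def by auto
    have c: "c \<in> men I" "v < n" "c < n"
      using cv P(1) perfect_matching_edge unfolding men_def by auto
    obtain u where u: "(c, u) \<in> N'" using partner_of_man_in P(2) c by blast
    have u': "u < n" using u P(2) perfect_matching_edge by blast
    have pv: "prefers (wprefs I ! v) c (partner_of_woman N' v)" using v unfolding B_def by auto
    \<comment> \<open>Otherwise \<open>(c, v)\<close> would block \<open>N'\<close>.\<close>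
    have "\<not> prefers (mprefs I ! c) v u"
      using N' u pv partner_of_woman_in[OF P(2) cv(2)] unfolding stable_matching_iff by blast
    moreover have "u \<noteq> v"
      using pv u partner_of_woman_eq P(2) prefers_irrefl wprefs(1) c(2) by metis
    ultimately have "prefers (mprefs I ! c) u v"
      using prefers_linear[of u _ v] mprefs(2) c u' by auto
    then show "c \<in> A" unfolding A_def
      using c u cv P partner_of_man_eq by (metis (mono_tags, lifting) mem_Collect_eq)
  qed
  have "inj_on (partner_of_man N') A"
    using partner_of_man_in[OF P(2)] partner_of_woman_eq[OF P(2)]
    unfolding inj_on_def A_def by (metis (no_types, lifting) mem_Collect_eq)
  then have "card A \<le> card B" using A_to_B fin card_inj_on_le by blast
  moreover have "inj_on (partner_of_woman N) B"
    using partner_of_woman_in[OF P(1)] partner_of_man_eq[OF P(1)]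
    unfolding inj_on_def B_def by (metis (no_types, lifting) mem_Collect_eq)
  then have "card (partner_of_woman N ` B) = card B" by (rule card_image)
  ultimately have surj: "partner_of_woman N ` B = A"
    using B_to_A fin card_seteq by metis
  have less: "a < n" "w < n" "b < n" "w' < n"
    using aw P perfect_matching_edge by blast+
  have "a \<noteq> b" using better prefers_irrefl wprefs(1) less by blast
  then have "w \<noteq> w'" using aw P(2) partner_of_woman_eq by metis
  then have "prefers (mprefs I ! a) w' w"
    using no prefers_linear[of w _ w'] mprefs(2) less by auto
  then have "a \<in> A" unfolding A_def men_def
    using less aw P partner_of_man_eq by (metis (mono_tags, lifting) lessThan_iff mem_Collect_eq)
  then obtain v where v: "v \<in> B" "a = partner_of_woman N v" using surj by auto
  then have "(a, v) \<in> N" using partner_of_woman_in P(1) unfolding B_def by blast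
  then have "v = w" using aw P(1) partner_of_man_eq by metis
  then have "prefers (wprefs I ! w) a b"
    using v aw P partner_of_woman_eq unfolding B_def by (metis (mono_tags, lifting) mem_Collect_eq)
  then show False using better prefers_asym wprefs(1) less by blast
qed

section \<open>Counting the members of a disjoint family that a list pointer has passed\<close>

definition passed :: "(nat \<times> nat) set set \<Rightarrow> nat \<Rightarrow> nat \<Rightarrow> nat" where
  "passed C a j = card {N \<in> C. \<exists>i<j. (a, choice a i) \<in> N}"

lemma finite_disjoint_stable_matchings:
  assumes "disjoint_stable_matchings I C"
  shows "finite C"
proof -
  have "C \<subseteq> Pow (men I \<times> women I)"
    using assms unfolding disjoint_stable_matchings_def stable_matching_def perfect_matching_def by auto
  then show ?thesis using finite_subset unfolding men_def women_def by blast
qed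

lemma passed_mono:
  assumes "disjoint_stable_matchings I C" "i \<le> j"
  shows "passed C a i \<le> passed C a j"
  unfolding passed_def using finite_disjoint_stable_matchings[OF assms(1)] assms(2)
  by (intro card_mono) (auto intro: less_le_trans)

lemma passed_zero: "passed C a 0 = 0"
  unfolding passed_def by simp

lemma passed_all:
  assumes "disjoint_stable_matchings I C" "a < n"
  shows "passed C a n = card C"
proof -
  have "\<exists>i<n. (a, choice a i) \<in> N" if "N \<in> C" for N
  proof -
    have P: "perfect_matching I N"
      using that assms(1) unfolding disjoint_stable_matchings_def stable_matching_def by auto
    have "(a, partner_of_man N a) \<in> N" using P partner_of_man_in assms(2) unfolding men_def by auto
    then show ?thesis using choice_surj[OF assms(2)] perfect_matching_edge[OF P] by metis
  qed
  then have "{N \<in> C. \<exists>i<n. (a, choice a i) \<in> N} = C" by auto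
  then show ?thesis unfolding passed_def by simp
qed

text \<open>By disjointness, at most one member contains the edge that a single pointer step
  passes.\<close>

lemma passed_Suc:
  assumes C: "disjoint_stable_matchings I C"
  shows "passed C a (Suc j) \<le> Suc (passed C a j)"
proof -
  have fin: "finite C" by (rule finite_disjoint_stable_matchings[OF C])
  have "card {N \<in> C. (a, choice a j) \<in> N} \<le> 1"
    using C fin unfolding disjoint_stable_matchings_def pairwise_def disjnt_def
    by (subst One_nat_def, subst card_le_Suc0_iff_eq) auto
  moreover have "{N \<in> C. \<exists>i<Suc j. (a, choice a i) \<in> N} =
      {N \<in> C. \<exists>i<j. (a, choice a i) \<in> N} \<union> {N \<in> C. (a, choice a j) \<in> N}"
    using less_Suc_eq by auto
  ultimately show ?thesis unfolding passed_def
    using card_Un_le[of "{N \<in> C. \<exists>i<j. (a, choice a i) \<in> N}" "{N \<in> C. (a, choice a j) \<in> N}"] by simp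
qed

text \<open>A rejection costs nothing, whereas \<open>passed_Suc\<close> alone would raise the bound
  by one: either no member contains \<open>(b, w)\<close>, or every member counted for
  \<open>b\<close> is already counted for \<open>a\<close>.\<close>

lemma passed_rejected:
  assumes C: "disjoint_stable_matchings I C"
    and ab: "a < n" "b < n" "j < n" "q < n" "choice a j = w" "choice b q = w"
    and better: "score w b < score w a"
    and passed: "passed C a j \<le> r" "passed C b q \<le> r"
  shows "passed C b (Suc q) \<le> r"
proof (cases "\<exists>N\<in>C. (b, w) \<in> N")
  case False
  then have "{N \<in> C. \<exists>i<Suc q. (b, choice b i) \<in> N} = {N \<in> C. \<exists>i<q. (b, choice b i) \<in> N}"
    using ab less_Suc_eq by auto
  then show ?thesis using passed unfolding passed_def by simp
next
  case True
  then obtain N0 where N0: "N0 \<in> C" "(b, w) \<in> N0" by blast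
  have st: "stable_matching I N" and P: "perfect_matching I N" if "N \<in> C" for N
    using that C unfolding disjoint_stable_matchings_def stable_matching_iff by auto
  have fin: "finite C" by (rule finite_disjoint_stable_matchings[OF C])
  have w: "w < n" using ab choice_less by blast
  define X where "X = {N \<in> C. \<exists>i<j. (a, choice a i) \<in> N}"
  define A where "A = {N \<in> C. \<exists>i<Suc q. (b, choice b i) \<in> N}"
  have disj: "(b, choice b i) \<notin> N" if N: "N \<in> C - X" and i: "i \<le> q" for N i
  proof
    assume bi: "(b, choice b i) \<in> N"
    have NC: "N \<in> C" using N by auto
    have "(a, partner_of_man N a) \<in> N" using partner_of_man_in[OF P[OF NC]] ab unfolding men_def by auto
    then obtain i' where i': "i' < n" "(a, choice a i') \<in> N"
      using choice_surj[OF ab(1)] perfect_matching_edge[OF P[OF NC]] by metis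
    have "j \<le> i'" using N NC i' unfolding X_def by (metis (mono_tags, lifting) DiffD2 mem_Collect_eq not_le)
    obtain d where d: "(d, w) \<in> N" using partner_of_woman_in[OF P[OF NC]] w unfolding women_def by blast
    have dn: "d < n" using d P[OF NC] perfect_matching_edge by blast
    \<comment> \<open>As \<open>N\<close> is not in \<open>X\<close>, the partner of
      \<open>a\<close> stands at position \<open>j\<close> or later. At \<open>j\<close> she is
      \<open>w\<close> herself; if later, \<open>w\<close> must not prefer \<open>a\<close> to
      \<open>d\<close>, or \<open>(a, w)\<close> would block \<open>N\<close>.\<close>
    have "score w a \<le> score w d"
    proof (cases "i' = j")
      case True
      then have "d = a" using d i' ab P[OF NC] partner_of_woman_eq by metis
      then show ?thesis by simp
    next
      case False
      then have "prefers (mprefs I ! a) w (choice a i')"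
        using prefers_choice_iff[of a j i'] \<open>j \<le> i'\<close> ab i' by auto
      then have "\<not> prefers (wprefs I ! w) a d"
        using st[OF NC] d i' unfolding stable_matching_iff by blast
      then show ?thesis using prefers_score_iff w ab dn by auto
    qed
    then have "prefers (wprefs I ! w) d b" using better prefers_score_iff w ab dn by auto
    \<comment> \<open>\<open>N0\<close> matches \<open>b\<close> with \<open>w\<close>, so her gain
      from \<open>N0\<close> to \<open>N\<close> is a loss for \<open>b\<close>, which is
      incompatible with \<open>i \<le> q\<close>.\<close>
    then have "prefers (mprefs I ! b) w (choice b i)"
      using opposition_of_interests[OF st[OF N0(1)] st[OF NC] N0(2) d bi] by blast
    then show False using prefers_choice_iff[of b q i] ab i by auto
  qed
  have "A \<subseteq> X"
  proof
    fix N assume "N \<in> A"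
    then obtain i where "N \<in> C" "i \<le> q" "(b, choice b i) \<in> N"
      unfolding A_def by (auto simp: less_Suc_eq_le)
    then show "N \<in> X" using disj by blast
  qed
  then have "card A \<le> card X" using fin unfolding X_def by (intro card_mono) auto
  then show ?thesis using passed(1) unfolding passed_def A_def X_def by simp
qed

section \<open>Repeated deferred acceptance\<close>

text \<open>Arguments of the invariants: \<open>pos a\<close> is the number of proposals made by man \<open>a\<close>, \<open>best w\<close> and
  \<open>H w\<close> are the score and the name of the best proposer of woman \<open>w\<close> in all rounds so far, \<open>r\<close> is the
  number of completed rounds, \<open>E w = Suc r\<close> says that \<open>w\<close> has accepted someone in the current round, and
  \<open>S\<close> is the set of currently engaged men.\<close>

definition proposals_inv :: "(nat \<Rightarrow> nat) \<Rightarrow> (nat \<Rightarrow> nat) \<Rightarrow> (nat \<Rightarrow> nat) \<Rightarrow> bool" where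
  "proposals_inv pos best H \<longleftrightarrow>
     (\<forall>a<n. pos a \<le> n) \<and>
     (\<forall>a<n. \<forall>j<pos a. score (choice a j) a \<le> best (choice a j)) \<and>
     (\<forall>w<n. 0 < best w \<longrightarrow>
        H w < n \<and> best w = score w (H w) \<and> (\<exists>j<pos (H w). choice (H w) j = w))"

text \<open>The partner of an engaged man is at position \<open>pos a - 1\<close>, since his pointer
  moves on as soon as he proposes. Stamps are round numbers plus one, so the initial 0 belongs to no
  round. Each completed round has used a proposal of every man, whence
  \<open>r \<le> pos a\<close>.\<close>

definition engaged_inv ::
  "(nat \<Rightarrow> nat) \<Rightarrow> (nat \<Rightarrow> nat) \<Rightarrow> (nat \<Rightarrow> nat) \<Rightarrow> (nat \<Rightarrow> nat) \<Rightarrow> nat \<Rightarrow> nat set \<Rightarrow> bool" where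
  "engaged_inv pos best H E r S \<longleftrightarrow>
     S \<subseteq> {..<n} \<and> (\<forall>a<n. r \<le> pos a) \<and> (\<forall>w<n. E w \<le> Suc r) \<and>
     (\<forall>w<n. E w = Suc r \<longrightarrow> 0 < best w \<and> H w \<in> S \<and> choice (H w) (pos (H w) - 1) = w) \<and>
     (\<forall>a\<in>S. r < pos a \<and> H (choice a (pos a - 1)) = a \<and> E (choice a (pos a - 1)) = Suc r)"

definition recorded_matching :: "(nat \<Rightarrow> nat) \<Rightarrow> nat \<Rightarrow> (nat \<times> nat) set" where
  "recorded_matching out i = {(a, w). a \<in> men I \<and> w = out (i * n + a)}"

text \<open>Row \<open>r\<close> of \<open>out\<close> belongs to the unfinished round and is
  constrained only for engaged men. The first clause makes later proposals differ from all recorded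
  partners, since pointers never go back.\<close>

definition recorded_inv :: "(nat \<Rightarrow> nat) \<Rightarrow> (nat \<Rightarrow> nat) \<Rightarrow> nat \<Rightarrow> nat set \<Rightarrow> bool" where
  "recorded_inv pos out r S \<longleftrightarrow>
     (\<forall>a<n. \<forall>i<r. \<exists>j<pos a. out (i * n + a) = choice a j) \<and>
     (\<forall>a<n. \<forall>i<r. \<forall>j<i. out (j * n + a) \<noteq> out (i * n + a)) \<and>
     (\<forall>a\<in>S. out (r * n + a) = choice a (pos a - 1) \<and> (\<forall>i<r. out (i * n + a) \<noteq> out (r * n + a))) \<and>
     (\<forall>i<r. stable_matching I (recorded_matching out i))"

text \<open>An engaged man has already proposed to his current partner but has not passed her.\<close>

definition optimal_inv :: "(nat \<Rightarrow> nat) \<Rightarrow> nat \<Rightarrow> nat set \<Rightarrow> bool" where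
  "optimal_inv pos r S \<longleftrightarrow>
     (\<forall>C. disjoint_stable_matchings I C \<longrightarrow>
        (\<forall>a<n. passed C a (if a \<in> S then pos a - 1 else pos a) \<le> r))"

definition rounds_inv where
  "rounds_inv pos best H E out r S \<longleftrightarrow>
     proposals_inv pos best H \<and> engaged_inv pos best H E r S \<and>
     recorded_inv pos out r S \<and> optimal_inv pos r S"

lemma rounds_inv_initial:
  "rounds_inv (\<lambda>_. 0) (\<lambda>_. 0) (\<lambda>_. 0) (\<lambda>_. 0) (\<lambda>_. 0) 0 {}"
  unfolding rounds_inv_def proposals_inv_def engaged_inv_def recorded_inv_def optimal_inv_def
  by (simp add: passed_zero)

lemma optimal_invD:
  assumes "optimal_inv pos r S" "disjoint_stable_matchings I C" "a < n" "j < pos a"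
  shows "passed C a j \<le> r"
proof -
  have "j \<le> (if a \<in> S then pos a - 1 else pos a)" using assms(4) by auto
  then show ?thesis using passed_mono[OF assms(2)] assms(1-3) unfolding optimal_inv_def
    by (meson order_trans)
qed

lemma index_eq_iff:
  assumes "a < n" "b < n"
  shows "i * n + a = j * n + b \<longleftrightarrow> i = j \<and> a = b"
proof
  assume e: "i * n + a = j * n + b"
  from arg_cong[OF e, of "\<lambda>k. k div n"] arg_cong[OF e, of "\<lambda>k. k mod n"] assms
  show "i = j \<and> a = b" by simp
qed auto

text \<open>The best proposer \<open>H w\<close>, possibly from an earlier round, has already
  proposed to \<open>w\<close>, while the pointer of \<open>x\<close> still stands at her. So
  \<open>H w\<close> is another man, strictly better than \<open>x\<close>, and
  \<open>passed_rejected\<close> applies.\<close>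

lemma rounds_inv_reject:
  assumes inv: "rounds_inv pos best H E out r S"
    and x: "x < n" "x \<notin> S" "pos x < n" "w = choice x (pos x)"
    and reject: "score w x \<le> best w"
  shows "rounds_inv (pos(x := Suc (pos x))) best H E out r S"
proof -
  have w: "w < n" using x choice_less by blast
  have inv': "proposals_inv pos best H" "engaged_inv pos best H E r S"
    "recorded_inv pos out r S" "optimal_inv pos r S"
    using inv unfolding rounds_inv_def by auto
  have "0 < best w" using score_pos[OF w x(1)] reject by simp
  then obtain j where h: "H w < n" "best w = score w (H w)" "j < pos (H w)" "choice (H w) j = w"
    using inv'(1) w unfolding proposals_inv_def by blast
  have j: "j < n" using h inv'(1) unfolding proposals_inv_def by (meson less_le_trans)
  have "H w \<noteq> x" using choice_eq_iff[OF x(1) j x(3)] h x(4) by auto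
  then have better: "score w x < score w (H w)"
    using score_eq_iff[OF w x(1) h(1)] reject h(2) by auto
  have "proposals_inv (pos(x := Suc (pos x))) best H"
    using inv'(1) x reject unfolding proposals_inv_def
    by (auto simp: less_Suc_eq)
  moreover have "engaged_inv (pos(x := Suc (pos x))) best H E r S"
    using inv'(2) x unfolding engaged_inv_def by (auto intro: le_SucI)
  moreover have "recorded_inv (pos(x := Suc (pos x))) out r S"
  proof -
    have "\<exists>j<(pos(x := Suc (pos x))) a. out (i * n + a) = choice a j" if "a < n" "i < r" for a i
    proof -
      obtain j where "j < pos a" "out (i * n + a) = choice a j"
        using inv'(3) \<open>a < n\<close> \<open>i < r\<close> unfolding recorded_inv_def by blast
      then show ?thesis by (intro exI[of _ j]) auto
    qed
    moreover have "(pos(x := Suc (pos x))) a = pos a" if "a \<in> S" for a using that x(2) by auto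
    ultimately show ?thesis
      using inv'(3) unfolding recorded_inv_def by (auto simp del: fun_upd_apply)
  qed
  moreover have "optimal_inv (pos(x := Suc (pos x))) r S"
    unfolding optimal_inv_def
  proof (intro allI impI)
    fix C a assume C: "disjoint_stable_matchings I C" and a: "a < n"
    have o: "passed C a (if a \<in> S then pos a - 1 else pos a) \<le> r" if "a < n" for a
      using inv'(4) C that unfolding optimal_inv_def by blast
    have "passed C x (Suc (pos x)) \<le> r"
      using passed_rejected[OF C h(1) x(1) j x(3) h(4) x(4)[symmetric] better
          optimal_invD[OF inv'(4) C h(1,3)]] o[OF x(1)] x(2) by simp
    then show "passed C a (if a \<in> S then (pos(x := Suc (pos x))) a - 1 else (pos(x := Suc (pos x))) a) \<le> r"
      using o[OF a] x(2) by (cases "a = x") auto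
  qed
  ultimately show ?thesis unfolding rounds_inv_def by blast
qed

text \<open>Only a holder accepted in the current round is displaced; otherwise the set removed is
  empty. The pointer of a displaced man passes \<open>w\<close>, and \<open>passed_rejected\<close>
  applies with \<open>x\<close> as the better suitor.\<close>

lemma rounds_inv_accept:
  assumes inv: "rounds_inv pos best H E out r S"
    and x: "x < n" "x \<notin> S" "pos x < n" "w = choice x (pos x)"
    and accept: "best w < score w x"
  shows "rounds_inv (pos(x := Suc (pos x))) (best(w := score w x)) (H(w := x)) (E(w := Suc r))
    (out(r * n + x := w)) r (insert x S - {v. E w = Suc r \<and> v = H w})"
    (is "rounds_inv ?pos ?best ?H ?E ?out r ?S")
proof -
  have w: "w < n" using x choice_less by blast
  have inv': "proposals_inv pos best H" "engaged_inv pos best H E r S"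
    "recorded_inv pos out r S" "optimal_inv pos r S"
    using inv unfolding rounds_inv_def by auto
  have S: "a < n" if "a \<in> S" for a using inv'(2) that unfolding engaged_inv_def by auto
  have r: "r \<le> pos x" using inv'(2) x unfolding engaged_inv_def by auto
  have p1: "\<And>a. a < n \<Longrightarrow> pos a \<le> n"
    and p2: "\<And>a j. a < n \<Longrightarrow> j < pos a \<Longrightarrow> score (choice a j) a \<le> best (choice a j)"
    and p3: "\<And>w. w < n \<Longrightarrow> 0 < best w \<Longrightarrow>
        H w < n \<and> best w = score w (H w) \<and> (\<exists>j<pos (H w). choice (H w) j = w)"
    using inv'(1) unfolding proposals_inv_def by auto
  have e1: "\<And>a. a < n \<Longrightarrow> r \<le> pos a"
    and e2: "\<And>w. w < n \<Longrightarrow> E w \<le> Suc r"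
    and e3: "\<And>w. w < n \<Longrightarrow> E w = Suc r \<Longrightarrow> 0 < best w \<and> H w \<in> S \<and> choice (H w) (pos (H w) - 1) = w"
    and e4: "\<And>a. a \<in> S \<Longrightarrow> r < pos a \<and> H (choice a (pos a - 1)) = a \<and> E (choice a (pos a - 1)) = Suc r"
    using inv'(2) unfolding engaged_inv_def by auto
  have "proposals_inv ?pos ?best ?H"
    unfolding proposals_inv_def
  proof (intro conjI allI impI)
    show "?pos a \<le> n" if "a < n" for a using p1 x that by auto
    show "score (choice a j) a \<le> ?best (choice a j)" if "a < n" "j < ?pos a" for a j
    proof -
      have "score (choice a j) a \<le> best (choice a j)" if "\<not> (a = x \<and> j = pos x)"
        using p2[OF \<open>a < n\<close>, of j] that \<open>j < ?pos a\<close> by (auto split: if_splits simp: less_Suc_eq)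
      then show ?thesis using accept x(4) by fastforce
    qed
    fix v assume v: "v < n" "0 < ?best v"
    show "?H v < n" "?best v = score v (?H v)"
      using v x p3 by (auto split: if_splits)
    show "\<exists>j<?pos (?H v). choice (?H v) j = v"
    proof (cases "v = w")
      case False
      then obtain j where "j < pos (H v)" "choice (H v) j = v" using p3 v by (auto split: if_splits)
      then show ?thesis using False by (intro exI[of _ j]) auto
    qed (use x in auto)
  qed
  moreover have "engaged_inv ?pos ?best ?H ?E r ?S"
    unfolding engaged_inv_def
  proof (intro conjI allI impI ballI)
    show "?S \<subseteq> {..<n}" using S x by auto
    show "r \<le> ?pos a" if "a < n" for a using e1[OF that] by auto
    show "?E v \<le> Suc r" if "v < n" for v using e2[OF that] by auto
    {
      fix v assume v: "v < n" "?E v = Suc r"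
      have "0 < ?best v \<and> ?H v \<in> ?S \<and> choice (?H v) (?pos (?H v) - 1) = v"
      proof (cases "v = w")
        case True
        moreover have "H w \<noteq> x" if "E w = Suc r" using e3[OF w that] x(2) by blast
        ultimately show ?thesis using True accept x(4)[symmetric] by auto
      next
        case False
        then have "E v = Suc r" using v by simp
        note g = e3[OF v(1) this]
        have "H v \<noteq> x" using g x by auto
        moreover have "H v \<noteq> H w" if "E w = Suc r" using e3[OF w that] g False by auto
        ultimately show ?thesis using g False by auto
      qed
    }
    then show "0 < ?best v" "?H v \<in> ?S" "choice (?H v) (?pos (?H v) - 1) = v"
      if "v < n" "?E v = Suc r" for v using that by blast+
    {
      fix a assume a: "a \<in> ?S"
      have "r < ?pos a \<and> ?H (choice a (?pos a - 1)) = a \<and> ?E (choice a (?pos a - 1)) = Suc r"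
      proof (cases "a = x")
        case False
        then have "a \<in> S" using a by auto
        then show ?thesis using e4[of a] False a by auto
      qed (use x r in auto)
    }
    then show "r < ?pos a" "?H (choice a (?pos a - 1)) = a" "?E (choice a (?pos a - 1)) = Suc r"
      if "a \<in> ?S" for a using that by blast+
  qed
  moreover have "recorded_inv ?pos ?out r ?S"
  proof -
    have keep: "?out (i * n + a) = out (i * n + a)" if "a < n" "i < r \<or> a \<noteq> x" for i a
      using that index_eq_iff[of a x i r] x by auto
    have rec: "recorded_matching ?out i = recorded_matching out i" if "i < r" for i
      unfolding recorded_matching_def men_def using keep that by auto
    have q1: "\<And>a i. a < n \<Longrightarrow> i < r \<Longrightarrow> \<exists>j<pos a. out (i * n + a) = choice a j"
      and q2: "\<And>a i j. a < n \<Longrightarrow> i < r \<Longrightarrow> j < i \<Longrightarrow> out (j * n + a) \<noteq> out (i * n + a)"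
      and q3: "\<And>a. a \<in> S \<Longrightarrow> out (r * n + a) = choice a (pos a - 1) \<and>
          (\<forall>i<r. out (i * n + a) \<noteq> out (r * n + a))"
      and q4: "\<And>i. i < r \<Longrightarrow> stable_matching I (recorded_matching out i)"
      using inv'(3) unfolding recorded_inv_def by auto
    show ?thesis
      unfolding recorded_inv_def
    proof (intro conjI allI impI ballI)
      fix a i assume a: "a < n" "i < r"
      show "\<exists>j<?pos a. ?out (i * n + a) = choice a j"
        using q1[OF a] keep[of a i] a by (auto intro: less_SucI)
      show "?out (j * n + a) \<noteq> ?out (i * n + a)" if "j < i" for j
        using q2[OF a that] keep[of a i] keep[of a j] a that by auto
    next
      fix i assume "i < r"
      then show "stable_matching I (recorded_matching ?out i)" using q4 rec by simp
    next
      fix a assume a: "a \<in> ?S"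
      show "?out (r * n + a) = choice a (?pos a - 1)"
      proof (cases "a = x")
        case False
        then show ?thesis using q3[of a] keep[of a r] a S by auto
      qed (use x in auto)
      fix i assume i: "i < r"
      show "?out (i * n + a) \<noteq> ?out (r * n + a)"
      proof (cases "a = x")
        case True
        \<comment> \<open>Recorded partners stand before the pointer of \<open>x\<close>, but
          \<open>w\<close> is at the pointer.\<close>
        obtain j where j: "j < pos x" "out (i * n + x) = choice x j" using q1[OF x(1) i] by blast
        then have "out (i * n + x) \<noteq> w" using choice_eq_iff[of x j "pos x"] x by auto
        then show ?thesis using True keep[of x i] x i by auto
      next
        case False
        then show ?thesis using q3[of a] keep[of a r] keep[of a i] a i S by auto
      qed
    qed
  qed
  moreover have "optimal_inv ?pos r ?S"
    unfolding optimal_inv_def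
  proof (intro allI impI)
    fix C a assume C: "disjoint_stable_matchings I C" and a: "a < n"
    have o: "passed C a (if a \<in> S then pos a - 1 else pos a) \<le> r" if "a < n" for a
      using inv'(4) C that unfolding optimal_inv_def by blast
    show "passed C a (if a \<in> ?S then ?pos a - 1 else ?pos a) \<le> r"
    proof (cases "E w = Suc r \<and> a = H w")
      case True
      \<comment> \<open>The displaced man plays the worse suitor \<open>b\<close> of
        \<open>passed_rejected\<close>, with \<open>q = pos a - 1\<close>; having left the engaged
        set, he needs the bound at \<open>pos a\<close>.\<close>
      have g: "a \<in> S" "choice a (pos a - 1) = w" "0 < best w" using e3[OF w] True by auto
      have "best w = score w a" using p3[OF w g(3)] True by auto
      moreover have "0 < pos a" "pos a - 1 < n" using e4[OF g(1)] p1[OF a] by auto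
      moreover have "a \<noteq> x" using g x by auto
      ultimately show ?thesis
        using passed_rejected[OF C x(1) a x(3) _ x(4)[symmetric] g(2)] o[OF a] o[OF x(1)] x accept g True
        by auto
    next
      case False
      then show ?thesis using o[OF a] x by (cases "a = x") auto
    qed
  qed
  ultimately show ?thesis unfolding rounds_inv_def by blast
qed

text \<open>With all men engaged, \<open>H\<close> inverts the assignment \<open>f\<close>, which is
  therefore a perfect matching. A woman whom a man prefers to his partner has already heard from
  him, and her partner attains the best score she has seen, so no pair blocks.\<close>

lemma rounds_inv_next_round:
  assumes inv: "rounds_inv pos best H E out r {..<n}"
  shows "rounds_inv pos best H E out (Suc r) {}"
proof -
  have p1: "\<And>a. a < n \<Longrightarrow> pos a \<le> n"
    and p2: "\<And>a j. a < n \<Longrightarrow> j < pos a \<Longrightarrow> score (choice a j) a \<le> best (choice a j)"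
    and p3: "\<And>w. w < n \<Longrightarrow> 0 < best w \<Longrightarrow>
        H w < n \<and> best w = score w (H w) \<and> (\<exists>j<pos (H w). choice (H w) j = w)"
    using inv unfolding rounds_inv_def proposals_inv_def by auto
  have e2: "\<And>w. w < n \<Longrightarrow> E w \<le> Suc r"
    and e3: "\<And>w. w < n \<Longrightarrow> E w = Suc r \<Longrightarrow> 0 < best w"
    and e4: "\<And>a. a < n \<Longrightarrow> r < pos a \<and> H (choice a (pos a - 1)) = a \<and> E (choice a (pos a - 1)) = Suc r"
    using inv unfolding rounds_inv_def engaged_inv_def by auto
  have rec: "recorded_inv pos out r {..<n}" using inv unfolding rounds_inv_def by blast
  have q1: "\<And>a i. a < n \<Longrightarrow> i < r \<Longrightarrow> \<exists>j<pos a. out (i * n + a) = choice a j"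
    and q2: "\<And>a i j. a < n \<Longrightarrow> i < r \<Longrightarrow> j < i \<Longrightarrow> out (j * n + a) \<noteq> out (i * n + a)"
    and q3: "\<And>a. a < n \<Longrightarrow> out (r * n + a) = choice a (pos a - 1) \<and>
        (\<forall>i<r. out (i * n + a) \<noteq> out (r * n + a))"
    and q4: "\<And>i. i < r \<Longrightarrow> stable_matching I (recorded_matching out i)"
    using rec unfolding recorded_inv_def by blast+
  define f where "f a = choice a (pos a - 1)" for a
  have M: "recorded_matching out r = {(a, w). a < n \<and> w = f a}"
    unfolding recorded_matching_def men_def f_def using q3 by auto
  have f_less: "f a < n" if "a < n" for a
    using that e4[OF that] p1[OF that] choice_less unfolding f_def by simp
  have Hf: "H (f a) = a" if "a < n" for a using e4 that unfolding f_def by auto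
  have inj: "inj_on f {..<n}" using Hf by (metis inj_onI lessThan_iff)
  have surj: "f ` {..<n} = {..<n}"
    using endo_inj_surj[OF _ _ inj] f_less by auto
  have P: "perfect_matching I (recorded_matching out r)"
    unfolding perfect_matching_def M men_def women_def
  proof (intro conjI ballI)
    show "{(a, w). a < n \<and> w = f a} \<subseteq> {..<n} \<times> {..<n}" using f_less by auto
    show "\<exists>!w. (a, w) \<in> {(a, w). a < n \<and> w = f a}" if "a \<in> {..<n}" for a using that by auto
    show "\<exists>!a. (a, w) \<in> {(a, w). a < n \<and> w = f a}" if "w \<in> {..<n}" for w
    proof -
      have "w \<in> f ` {..<n}" using surj that by simp
      then obtain a where a: "a < n" "w = f a" by auto
      then have "c = a" if "c < n" "w = f c" for c using Hf that by metis
      then show ?thesis using a by blast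
    qed
  qed
  have st: "stable_matching I (recorded_matching out r)"
    unfolding stable_matching_iff
  proof (intro conjI allI impI notI P)
    fix a w' b w
    assume ab: "(a, w') \<in> recorded_matching out r" "(b, w) \<in> recorded_matching out r"
      and bl: "prefers (wprefs I ! w) a b \<and> prefers (mprefs I ! a) w w'"
    have ab': "a < n" "w' = f a" "b < n" "w = f b" using ab unfolding M by auto
    have w: "w < n" using f_less ab' by simp
    obtain j where j: "j < n" "choice a j = w" using choice_surj[OF ab'(1) w] by blast
    have pa: "pos a - 1 < n" "0 < pos a" using e4[OF ab'(1)] p1[OF ab'(1)] by auto
    have "j < pos a - 1" using bl prefers_choice_iff[OF ab'(1) j(1) pa(1)] j ab' unfolding f_def by simp
    then have "score w a \<le> best w" using p2[OF ab'(1), of j] j by auto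
    also have "best w = score w b"
    proof -
      have "E w = Suc r" using e4[OF ab'(3)] ab'(4) unfolding f_def by blast
      then show ?thesis using p3[OF w e3[OF w]] Hf[OF ab'(3)] ab'(4) by metis
    qed
    finally show False using bl prefers_score_iff[OF w ab'(1,3)] by simp
  qed
  have "engaged_inv pos best H E (Suc r) {}"
  proof -
    have "E w \<le> Suc (Suc r)" "E w \<noteq> Suc (Suc r)" if "w < n" for w using e2[OF that] by auto
    moreover have "Suc r \<le> pos a" if "a < n" for a using e4[OF that] by auto
    ultimately show ?thesis unfolding engaged_inv_def by blast
  qed
  moreover have "recorded_inv pos out (Suc r) {}"
    unfolding recorded_inv_def
  proof (intro conjI allI impI)
    fix a i assume a: "a < n" "i < Suc r"
    show "\<exists>j<pos a. out (i * n + a) = choice a j"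
    proof (cases "i = r")
      case True
      then show ?thesis using q3[OF a(1)] e4[OF a(1)] by (intro exI[of _ "pos a - 1"]) auto
    qed (use q1 a in auto)
    show "out (j * n + a) \<noteq> out (i * n + a)" if "j < i" for j
      using q2[of a i j] q3[of a] a that by (cases "i = r") auto
  next
    fix i assume "i < Suc r"
    then show "stable_matching I (recorded_matching out i)" using q4 st by (cases "i = r") auto
  qed auto
  moreover have "optimal_inv pos (Suc r) {}"
    unfolding optimal_inv_def
  proof (intro allI impI)
    fix C a assume C: "disjoint_stable_matchings I C" and a: "a < n"
    \<comment> \<open>Releasing the men makes their current partners count as passed; by
      \<open>passed_Suc\<close> this costs at most one, which the new round number absorbs.\<close>
    have "passed C a (pos a - 1) \<le> r"
      using inv C a unfolding rounds_inv_def optimal_inv_def by auto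
    then show "passed C a (if a \<in> {} then pos a - 1 else pos a) \<le> Suc r"
      using passed_Suc[OF C, of a "pos a - 1"] e4[OF a] by simp
  qed
  ultimately show ?thesis using inv unfolding rounds_inv_def by blast
qed

text \<open>The free man \<open>x\<close> has passed his partner in every member of a competing
  family, so its size is at most \<open>r\<close>, which the recorded matchings attain.\<close>

lemma rounds_inv_exhausted:
  assumes inv: "rounds_inv pos best H E out r S" and x: "x < n" "x \<notin> S" "pos x = n"
  shows "distinct (map (recorded_matching out) [0..<r])"
    and "largest_disjoint_stable_matchings I (set (map (recorded_matching out) [0..<r]))"
proof -
  have q2: "\<And>a i j. a < n \<Longrightarrow> i < r \<Longrightarrow> j < i \<Longrightarrow> out (j * n + a) \<noteq> out (i * n + a)"
    and q4: "\<And>i. i < r \<Longrightarrow> stable_matching I (recorded_matching out i)"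
    using inv unfolding rounds_inv_def recorded_inv_def by auto
  have disj: "disjnt (recorded_matching out i) (recorded_matching out j)" if "i < r" "j < r" "i \<noteq> j" for i j
    using q2[of _ i j] q2[of _ j i] that
    unfolding disjnt_def recorded_matching_def men_def by (cases i j rule: linorder_cases) force+
  \<comment> \<open>Disjoint sets can coincide only when empty, which the existence of man
    \<open>x\<close> rules out.\<close>
  have "recorded_matching out i \<noteq> {}" for i
    using x unfolding recorded_matching_def men_def by auto
  then have inj: "inj_on (recorded_matching out) {0..<r}"
    using disj unfolding inj_on_def disjnt_def by (metis atLeastLessThan_iff inf.idem)
  then show "distinct (map (recorded_matching out) [0..<r])" by (simp add: distinct_map)
  have "card C \<le> r" if C: "disjoint_stable_matchings I C" for C
    using inv C x passed_all[OF C x(1)] unfolding rounds_inv_def optimal_inv_def by metis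
  moreover have "pairwise disjnt (recorded_matching out ` {0..<r})"
    using disj by (intro pairwise_imageI) auto
  ultimately show "largest_disjoint_stable_matchings I (set (map (recorded_matching out) [0..<r]))"
    unfolding largest_disjoint_stable_matchings_def disjoint_stable_matchings_def
    using q4 inj by (auto simp: card_image)
qed

end

section \<open>Total correctness with step counts\<close>

text \<open>Covers loop-free code, with \<open>fits\<close> built in so that getting stuck is
  excluded. Loops are left to \<open>while_exec\<close>, hence \<open>False\<close> for
  \<open>While\<close>.\<close>

fun wp :: "nat \<Rightarrow> com \<Rightarrow> (ram_state \<Rightarrow> bool) \<Rightarrow> ram_state \<Rightarrow> bool" where
  "wp W Skip Q s = Q s"
| "wp W (Assign x e) Q s = (fits W (asubs e) s \<and> Q (set_reg x (aval e s) s))"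
| "wp W (Put a i e) Q s = (fits W (asubs i \<union> asubs e) s \<and> Q (set_mem a (aval i s) (aval e s) s))"
| "wp W (Seq p q) Q s = wp W p (wp W q Q) s"
| "wp W (If b p q) Q s = (fits W (bsubs b) s \<and> (if bval b s then wp W p Q s else wp W q Q s))"
| "wp W (While b p) Q s = False"

fun max_cost :: "com \<Rightarrow> nat" where
  "max_cost Skip = 1"
| "max_cost (Assign x e) = 1 + acost e"
| "max_cost (Put a i e) = 1 + acost i + acost e"
| "max_cost (Seq p q) = max_cost p + max_cost q"
| "max_cost (If b p q) = 1 + bcost b + max_cost p + max_cost q"
| "max_cost (While b p) = 0"

lemma wp_exec: "wp W p Q s \<Longrightarrow> \<exists>t s'. exec W p s t s' \<and> t \<le> max_cost p \<and> Q s'"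
proof (induction p arbitrary: Q s)
  case (Seq p q)
  from Seq.IH(1)[of "wp W q Q" s] Seq.prems obtain t s' where
    p: "exec W p s t s'" "t \<le> max_cost p" "wp W q Q s'" by auto
  from Seq.IH(2)[OF p(3)] obtain u s'' where
    "exec W q s' u s''" "u \<le> max_cost q" "Q s''" by auto
  with p show ?case by (metis add_mono exec.Seq max_cost.simps(4))
next
  case (If b p q)
  show ?case
  proof (cases "bval b s")
    case True
    then obtain t s' where "exec W p s t s'" "t \<le> max_cost p" "Q s'"
      using If.IH(1)[of Q s] If.prems by auto
    moreover have "exec W (com.If b p q) s (1 + bcost b + t) s'"
      using True If.prems calculation by (intro exec.IfTrue) auto
    ultimately show ?thesis by fastforce
  next
    case False
    then obtain t s' where "exec W q s t s'" "t \<le> max_cost q" "Q s'"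
      using If.IH(2)[of Q s] If.prems by auto
    moreover have "exec W (com.If b p q) s (1 + bcost b + t) s'"
      using False If.prems calculation by (intro exec.IfFalse) auto
    ultimately show ?thesis by fastforce
  qed
qed (fastforce intro: exec.intros)+

text \<open>At most \<open>\<mu> s\<close> iterations occur; the extra share in
  \<open>\<mu> s + 1\<close> pays for the final failing test.\<close>

lemma while_exec:
  assumes guard: "\<And>s. P s \<Longrightarrow> fits W (bsubs b) s"
    and body: "\<And>s. P s \<Longrightarrow> bval b s \<Longrightarrow> wp W p (\<lambda>s'. P s' \<and> \<mu> s' < (\<mu> s :: nat)) s"
    and init: "P s"
  shows "\<exists>t s'. exec W (While b p) s t s' \<and> t \<le> (\<mu> s + 1) * (1 + bcost b + max_cost p) \<and>
           P s' \<and> \<not> bval b s'"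
  using init
proof (induction "\<mu> s" arbitrary: s rule: less_induct)
  case less
  let ?K = "1 + bcost b + max_cost p"
  show ?case
  proof (cases "bval b s")
    case True
    then obtain t s' where p: "exec W p s t s'" "t \<le> max_cost p" "P s'" "\<mu> s' < \<mu> s"
      using wp_exec[OF body] less.prems by blast
    then obtain u s'' where q: "exec W (While b p) s' u s''" "u \<le> (\<mu> s' + 1) * ?K" "P s''" "\<not> bval b s''"
      using less.hyps by blast
    have "exec W (While b p) s (1 + bcost b + t + u) s''"
      using guard[OF less.prems] True p(1) q(1) by (rule exec.WhileTrue)
    moreover have "(\<mu> s' + 1) * ?K \<le> \<mu> s * ?K" using p(4) by (intro mult_right_mono) auto
    then have "1 + bcost b + t + u \<le> (\<mu> s + 1) * ?K" using p(2) q(2) by simp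
    ultimately show ?thesis using q by blast
  next
    case False
    then have "exec W (While b p) s (1 + bcost b) s"
      using guard[OF less.prems] by (intro exec.WhileFalse)
    then show ?thesis using False less.prems by fastforce
  qed
qed

section \<open>The program\<close>

text \<open>The rank loop runs through all cells \<open>i\<close> of \<open>wprefs\<close>; \<open>b\<close> is the start of the row containing \<open>i\<close>,
  which avoids a division.\<close>

definition rank_body :: com where
  "rank_body =
     Seq (Put ''score'' (Plus (Reg ''b'') (Get ''wprefs'' (Reg ''i'')))
            (Minus (Plus (Reg ''b'') (Reg ''n'')) (Reg ''i'')))
    (Seq (Assign ''i'' (Plus (Reg ''i'') (Const 1)))
         (If (Equal (Reg ''i'') (Plus (Reg ''b'') (Reg ''n'')))
            (Assign ''b'' (Reg ''i'')) Skip))"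

definition rank_guard :: bexp where
  "rank_guard = Less (Reg ''i'') (Times (Reg ''n'') (Reg ''n''))"

text \<open>The array \<open>out\<close> is written at every acceptance; the entries of displaced men are overwritten
  when they are accepted again, so a completed round needs no separate output pass. Stamping
  \<open>round\<close> with the round number dissolves all engagements at once when a round ends.\<close>

definition accept_body :: com where
  "accept_body =
     Seq (Put ''best'' (Reg ''w'') (Reg ''s''))
    (Seq (Put ''out'' (Plus (Times (Reg ''count'') (Reg ''n'')) (Reg ''x'')) (Reg ''w''))
    (Seq (Assign ''y'' (Get ''holder'' (Reg ''w'')))
    (Seq (Put ''holder'' (Reg ''w'') (Reg ''x''))
         (If (Equal (Get ''round'' (Reg ''w'')) (Plus (Reg ''count'') (Const 1)))
            (Assign ''x'' (Reg ''y''))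
            (Seq (Put ''round'' (Reg ''w'') (Plus (Reg ''count'') (Const 1)))
            (Seq (Assign ''m'' (Plus (Reg ''m'') (Const 1)))
            (Seq (Assign ''x'' (Reg ''m''))
                 (If (Equal (Reg ''m'') (Reg ''n''))
                    (Seq (Assign ''count'' (Plus (Reg ''count'') (Const 1)))
                    (Seq (Assign ''m'' (Const 0)) (Assign ''x'' (Const 0))))
                    Skip))))))))"

text \<open>Register \<open>x\<close> holds the only free man among those who have entered the
  round, namely men \<open>0\<close> to \<open>m\<close>. A rejection leaves \<open>x\<close>
  unchanged, so the same man goes on to his next choice.\<close>

definition propose_body :: com where
  "propose_body =
     If (Equal (Get ''pos'' (Reg ''x'')) (Reg ''n''))
       (Assign ''stop'' (Const 1))
       (Seq (Assign ''w'' (Get ''mprefs'' (Plus (Times (Reg ''x'') (Reg ''n'')) (Get ''pos'' (Reg ''x'')))))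
       (Seq (Put ''pos'' (Reg ''x'') (Plus (Get ''pos'' (Reg ''x'')) (Const 1)))
       (Seq (Assign ''s'' (Get ''score'' (Plus (Times (Reg ''w'') (Reg ''n'')) (Reg ''x''))))
            (If (Less (Get ''best'' (Reg ''w'')) (Reg ''s'')) accept_body Skip))))"

definition propose_guard :: bexp where
  "propose_guard = Equal (Reg ''stop'') (Const 0)"

text \<open>The empty instance has exactly one stable matching, the empty one, but the proposal loop would
  stop there before completing a round.\<close>

definition program :: com where
  "program =
     Seq (While rank_guard rank_body)
         (If (Equal (Reg ''n'') (Const 0)) (Assign ''count'' (Const 1))
            (While propose_guard propose_body))"

section \<open>Correctness of the program\<close>

lemma reg_set_reg [simp]: "reg (set_reg x v s) = (reg s)(x := v)"
  and mem_set_reg [simp]: "mem (set_reg x v s) = mem s"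
  and reg_set_mem [simp]: "reg (set_mem a i v s) = reg s"
  and mem_set_mem [simp]: "mem (set_mem a i v s) = (mem s)(a := (mem s a)(i := v))"
  by (simp_all add: set_reg_def set_mem_def)

context stable_marriage
begin

section \<open>The score table\<close>

definition input_intact :: "ram_state \<Rightarrow> bool" where
  "input_intact s \<longleftrightarrow> reg s ''n'' = n \<and>
     mem s ''mprefs'' = rows n (mprefs I) \<and> mem s ''wprefs'' = rows n (wprefs I)"

text \<open>The proposal loop needs these to be zero at its start; the rank loop leaves them
  alone.\<close>

definition unused :: "ram_state \<Rightarrow> bool" where
  "unused s \<longleftrightarrow> (\<forall>x\<in>{''x'', ''m'', ''count'', ''stop''}. reg s x = 0) \<and>
     (\<forall>a\<in>{''pos'', ''best'', ''holder'', ''round'', ''out''}. mem s a = (\<lambda>_. 0))"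

text \<open>Cell \<open>k\<close> of \<open>wprefs\<close> names the man at rank
  \<open>k mod n\<close> of woman \<open>k div n\<close>; this is the cell of \<open>score\<close>
  belonging to that woman and man.\<close>

definition score_address :: "nat \<Rightarrow> nat" where
  "score_address k = k div n * n + rows n (wprefs I) k"

definition rank_inv :: "ram_state \<Rightarrow> bool" where
  "rank_inv s \<longleftrightarrow> input_intact s \<and> unused s \<and> reg s ''i'' \<le> n * n \<and>
     reg s ''b'' = reg s ''i'' div n * n \<and>
     (\<forall>k<reg s ''i''. mem s ''score'' (score_address k) = n - k mod n)"

lemma index_less:
  assumes "a < (p :: nat)" "j < q"
  shows "a * q + j < p * q"
proof -
  have "a * q + j < Suc a * q" using assms by simp
  also have "\<dots> \<le> p * q" using assms by (intro mult_right_mono) auto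
  finally show ?thesis .
qed

lemma rows_choice: "a < n \<Longrightarrow> j < n \<Longrightarrow> rows n (mprefs I) (a * n + j) = choice a j"
  using index_less[of a n j n] unfolding rows_def choice_def by simp

lemma rows_wprefs_less:
  assumes "k < n * n"
  shows "rows n (wprefs I) k < n"
proof -
  have "0 < n" using assms by (cases "n = 0") auto
  then have "k div n < n" "k mod n < n" using assms by (auto simp: less_mult_imp_div_less)
  then show ?thesis using assms wprefs(2) length_wprefs nth_mem unfolding rows_def by (metis lessThan_iff)
qed

text \<open>The row determines the woman and, her list being free of repetitions, the entry
  determines the rank. Hence the rank loop never overwrites a stored score.\<close>

lemma score_address_inj:
  assumes "k < n * n" "l < n * n" "score_address k = score_address l"
  shows "k = l"
proof -
  have e: "k div n = l div n" "rows n (wprefs I) k = rows n (wprefs I) l"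
    using index_eq_iff[OF rows_wprefs_less[OF assms(1)] rows_wprefs_less[OF assms(2)]] assms(3)
    unfolding score_address_def by auto
  have "0 < n" using assms by (cases "n = 0") auto
  then have d: "k div n < n" "k mod n < n" "l mod n < n"
    using assms by (auto simp: less_mult_imp_div_less)
  have "k mod n = l mod n"
    using e assms d wprefs(1)[OF d(1)] length_wprefs[OF d(1)] unfolding rows_def
    by (simp add: nth_eq_iff_index_eq)
  then show ?thesis using e(1) by (metis div_mult_mod_eq)
qed

lemma score_address_less: "k < n * n \<Longrightarrow> score_address k < n * n"
  unfolding score_address_def
  using index_less rows_wprefs_less by (simp add: less_mult_imp_div_less)

lemma rank_body_correct:
  assumes inv: "rank_inv s" and guard: "bval rank_guard s" and W: "2 * (n * n) + n + 2 \<le> W"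
  shows "wp W rank_body (\<lambda>s'. rank_inv s' \<and> n * n - reg s' ''i'' < n * n - reg s ''i'') s"
proof -
  define i where "i = reg s ''i''"
  have s: "reg s ''n'' = n" "mem s ''wprefs'' = rows n (wprefs I)" "reg s ''b'' = i div n * n"
    "mem s ''mprefs'' = rows n (mprefs I)" "unused s"
    using inv unfolding rank_inv_def input_intact_def i_def by auto
  have i: "i < n * n" using guard s unfolding rank_guard_def i_def by simp
  then have n: "0 < n" by (cases "n = 0") auto
  have d: "i div n < n" "i mod n < n" using i n by (auto simp: less_mult_imp_div_less)
  have e: "i = i div n * n + i mod n" by simp
  have wi: "rows n (wprefs I) i < n" by (rule rows_wprefs_less[OF i])
  have addr: "i div n * n + rows n (wprefs I) i = score_address i" unfolding score_address_def by simp
  have score: "mem s ''score'' (score_address k) = n - k mod n" if "k < i" for k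
    using inv that unfolding rank_inv_def i_def by auto
  have new: "i div n * n + n - i = n - i mod n" using e d by linarith
  have b: "i div n * n + n \<le> n * n" using d(1) by (metis Suc_leI add.commute mult_Suc mult_le_mono1)
  have al: "score_address i < n * n" by (rule score_address_less[OF i])
  let ?sc = "(mem s ''score'')(score_address i := n - i mod n)"
  have sc: "\<forall>k<Suc i. ?sc (score_address k) = n - k mod n"
  proof (intro allI impI)
    fix k assume "k < Suc i"
    show "?sc (score_address k) = n - k mod n"
    proof (cases "k = i")
      case False
      then have "k < i" using \<open>k < Suc i\<close> by simp
      then have "score_address k \<noteq> score_address i" using score_address_inj[of k i] i by auto
      then show ?thesis using score[OF \<open>k < i\<close>] by simp
    qed simp
  qed
  have wrap: "Suc i = i div n * n + n \<longleftrightarrow> Suc (i mod n) = n" using e by linarith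
  have div: "Suc i div n * n = (if Suc i = i div n * n + n then Suc i else i div n * n)"
  proof (cases "Suc (i mod n) = n")
    case True
    then have "Suc i div n = Suc (i div n)" by (simp add: div_Suc mod_Suc)
    then have "Suc i div n * n = i div n * n + n" by simp
    then have "Suc i div n * n = Suc i" using wrap True by linarith
    then show ?thesis by (simp only: wrap True if_True simp_thms)
  next
    case False
    then have "Suc i div n = i div n" using n by (simp add: div_Suc mod_Suc)
    then show ?thesis by (simp only: wrap False if_False)
  qed
  have small: "n - i mod n < W" using W by linarith
  have progress: "n * n - Suc i < n * n - i"
    "Suc i = i div n * n + n \<Longrightarrow> n * n - (i div n * n + n) < n * n - i"
    using i by linarith+
  show ?thesis
    unfolding rank_body_def
    using s i wi al W b sc div new small progress
    by (simp add: fits_def i_def[symmetric] addr rank_inv_def input_intact_def unused_def)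
qed

lemma rank_loop:
  assumes init: "rank_inv s" and W: "2 * (n * n) + n + 2 \<le> W"
  shows "\<exists>t s'. exec W (While rank_guard rank_body) s t s' \<and>
    t \<le> (n * n + 1) * (1 + bcost rank_guard + max_cost rank_body) \<and>
    input_intact s' \<and> unused s' \<and> (\<forall>w<n. \<forall>a<n. mem s' ''score'' (w * n + a) = score w a)"
proof -
  have "\<exists>t s'. exec W (While rank_guard rank_body) s t s' \<and>
     t \<le> (n * n - reg s ''i'' + 1) * (1 + bcost rank_guard + max_cost rank_body) \<and>
     rank_inv s' \<and> \<not> bval rank_guard s'"
  proof (rule while_exec[where \<mu> = "\<lambda>s. n * n - reg s ''i''"])
    show "fits W (bsubs rank_guard) s" if "rank_inv s" for s
      using that W le_square[of n] unfolding rank_guard_def fits_def rank_inv_def input_intact_def by auto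
    show "wp W rank_body (\<lambda>s'. rank_inv s' \<and> n * n - reg s' ''i'' < n * n - reg s ''i'') s"
      if "rank_inv s" "bval rank_guard s" for s
      using rank_body_correct that W by blast
  qed (rule init)
  then obtain t s' where e: "exec W (While rank_guard rank_body) s t s'"
    "t \<le> (n * n - reg s ''i'' + 1) * (1 + bcost rank_guard + max_cost rank_body)"
    "rank_inv s'" "\<not> bval rank_guard s'" by blast
  have "t \<le> (n * n + 1) * (1 + bcost rank_guard + max_cost rank_body)"
    using e(2) by (rule order_trans) (intro mult_right_mono, auto)
  moreover have i: "reg s' ''i'' = n * n"
    using e(3,4) unfolding rank_guard_def rank_inv_def input_intact_def by simp
  have "mem s' ''score'' (w * n + a) = score w a" if w: "w < n" "a < n" for w a
  proof -
    \<comment> \<open>With \<open>j\<close> the rank of \<open>a\<close> for \<open>w\<close>, his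
      score was written when \<open>i\<close> was \<open>w * n + j\<close>.\<close>
    obtain j where j: "j < n" "a = wprefs I ! w ! j"
      using w wprefs(2) length_wprefs by (metis in_set_conv_nth lessThan_iff)
    have k: "w * n + j < n * n" using index_less w j by blast
    have dm: "(w * n + j) div n = w" "(w * n + j) mod n = j" using j by auto
    have "score_address (w * n + j) = w * n + a"
      unfolding score_address_def rows_def using k dm j by simp
    moreover have "mem s' ''score'' (score_address (w * n + j)) = n - (w * n + j) mod n"
      using e(3) i k unfolding rank_inv_def by auto
    ultimately show ?thesis using score_nth w j dm by simp
  qed
  ultimately show ?thesis using e(1,3) unfolding rank_inv_def by blast
qed

section \<open>The proposal loop\<close>

text \<open>Men \<open>0\<close> to \<open>m\<close> have entered the round and all but
  \<open>x\<close> are engaged. \<open>H\<close> is bounded for every woman, even one without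
  proposals, so that reading her holder fits a machine word.\<close>

definition loop_inv where
  "loop_inv pos best H E out r m x stop \<longleftrightarrow>
     rounds_inv pos best H E out r ({..m} - {x}) \<and> x \<le> m \<and> m < n \<and> (\<forall>w<n. H w < n) \<and>
     (stop = 0 \<or> stop = (1 :: nat) \<and> pos x = n)"

lemma loop_inv_bounds:
  assumes "loop_inv pos best H E out r m x stop"
  shows "x < n" "m < n" "r \<le> pos x" "pos a \<le> n \<or> n \<le> a" "sum pos {..<n} \<le> n * n"
    "w < n \<Longrightarrow> H w < n" "w < n \<Longrightarrow> E w \<le> Suc r" "w < n \<Longrightarrow> best w \<le> n" "stop \<le> 1"
proof -
  have P: "proposals_inv pos best H" and E: "engaged_inv pos best H E r ({..m} - {x})"
    using assms unfolding loop_inv_def rounds_inv_def by auto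
  show x: "x < n" and "m < n" "w < n \<Longrightarrow> H w < n" "stop \<le> 1"
    using assms unfolding loop_inv_def by auto
  show "r \<le> pos x" "w < n \<Longrightarrow> E w \<le> Suc r" using E x unfolding engaged_inv_def by auto
  have p: "pos a \<le> n" if "a < n" for a using P that unfolding proposals_inv_def by auto
  then show "pos a \<le> n \<or> n \<le> a" by force
  show "sum pos {..<n} \<le> n * n" using sum_bounded_above[of "{..<n}" pos n] p by auto
  show "best w \<le> n" if "w < n"
    using P that score_le unfolding proposals_inv_def by (metis le0 not_gr0)
qed

lemma loop_inv_reject:
  assumes "loop_inv pos best H E out r m x 0" "pos x < n"
    "score (choice x (pos x)) x \<le> best (choice x (pos x))"
  shows "loop_inv (pos(x := Suc (pos x))) best H E out r m x 0"
  using assms rounds_inv_reject[of pos best H E out r "{..m} - {x}" x] unfolding loop_inv_def by simp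

lemma loop_inv_displace:
  assumes inv: "loop_inv pos best H E out r m x 0" and x: "pos x < n" "w = choice x (pos x)"
    and accept: "best w < score w x" and displace: "E w = Suc r"
  shows "loop_inv (pos(x := Suc (pos x))) (best(w := score w x)) (H(w := x)) E
    (out(r * n + x := w)) r m (H w) 0"
proof -
  have m: "x \<le> m" "m < n" "\<forall>w<n. H w < n" and R: "rounds_inv pos best H E out r ({..m} - {x})"
    using inv unfolding loop_inv_def by auto
  have w: "w < n" using x m choice_less by auto
  have "H w \<in> {..m} - {x}"
    using R w displace unfolding rounds_inv_def engaged_inv_def by blast
  moreover have "insert x ({..m} - {x}) - {v. E w = Suc r \<and> v = H w} = {..m} - {H w}"
    using m displace by auto
  moreover have "E(w := Suc r) = E" using displace by auto
  ultimately show ?thesis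
    using rounds_inv_accept[OF R _ _ x accept] m unfolding loop_inv_def by simp
qed

text \<open>No man is displaced, so all of \<open>0\<close> to \<open>m\<close> are engaged. Either
  this completes the round and man \<open>0\<close> opens the next, or man \<open>Suc m\<close>
  enters as the free one.\<close>

lemma loop_inv_engage:
  assumes inv: "loop_inv pos best H E out r m x 0" and x: "pos x < n" "w = choice x (pos x)"
    and accept: "best w < score w x" and engage: "E w \<noteq> Suc r"
  shows "if Suc m = n
    then loop_inv (pos(x := Suc (pos x))) (best(w := score w x)) (H(w := x)) (E(w := Suc r))
      (out(r * n + x := w)) (Suc r) 0 0 0
    else loop_inv (pos(x := Suc (pos x))) (best(w := score w x)) (H(w := x)) (E(w := Suc r))
      (out(r * n + x := w)) r (Suc m) (Suc m) 0"
proof -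
  have m: "x \<le> m" "m < n" "\<forall>w<n. H w < n" and R: "rounds_inv pos best H E out r ({..m} - {x})"
    using inv unfolding loop_inv_def by auto
  have S: "insert x ({..m} - {x}) - {v. E w = Suc r \<and> v = H w} = {..m}"
    using m engage by auto
  have R': "rounds_inv (pos(x := Suc (pos x))) (best(w := score w x)) (H(w := x)) (E(w := Suc r))
      (out(r * n + x := w)) r {..m}"
    using rounds_inv_accept[OF R _ _ x accept] m S by simp
  show ?thesis
  proof (cases "Suc m = n")
    case True
    have "{..m} = {..<n}" using True by auto
    moreover have "{..0} - {0} = ({} :: nat set)" by auto
    ultimately show ?thesis using R' rounds_inv_next_round True m unfolding loop_inv_def by simp
  next
    case False
    have "{..m} = {..Suc m} - {Suc m}" by auto
    then show ?thesis using R' False m unfolding loop_inv_def by simp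
  qed
qed

definition main_inv :: "ram_state \<Rightarrow> bool" where
  "main_inv s \<longleftrightarrow> input_intact s \<and> (\<forall>w<n. \<forall>a<n. mem s ''score'' (w * n + a) = score w a) \<and>
     loop_inv (mem s ''pos'') (mem s ''best'') (mem s ''holder'') (mem s ''round'') (mem s ''out'')
       (reg s ''count'') (reg s ''m'') (reg s ''x'') (reg s ''stop'')"

text \<open>Bounds the remaining iterations: each either makes one of at most \<open>n * n\<close>
  proposals or sets \<open>stop\<close>, for which the summand \<open>1\<close> pays.\<close>

definition fuel :: "ram_state \<Rightarrow> nat" where
  "fuel s = n * n + 1 - reg s ''stop'' - sum (mem s ''pos'') {..<n}"

lemma propose_body_correct:
  assumes inv: "main_inv s" and guard: "bval propose_guard s" and W: "2 * (n * n) + 4 * n + 4 \<le> W"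
  shows "wp W propose_body (\<lambda>s'. main_inv s' \<and> fuel s' < fuel s) s"
proof -
  define pos best H E out where
    defs: "pos = mem s ''pos''" "best = mem s ''best''" "H = mem s ''holder''" "E = mem s ''round''"
      "out = mem s ''out''"
  define r m x where regs: "r = reg s ''count''" "m = reg s ''m''" "x = reg s ''x''"
  note fold = defs[symmetric] regs[symmetric]
  have stop: "reg s ''stop'' = 0" using guard unfolding propose_guard_def by simp
  have s: "reg s ''n'' = n" "mem s ''mprefs'' = rows n (mprefs I)" "mem s ''wprefs'' = rows n (wprefs I)"
    and score: "\<And>w a. w < n \<Longrightarrow> a < n \<Longrightarrow> mem s ''score'' (w * n + a) = score w a"
    and L: "loop_inv pos best H E out r m x 0"
    using inv stop unfolding main_inv_def input_intact_def fold by auto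
  note B = loop_inv_bounds[OF L]
  have x: "x < n" by (rule B(1))
  have px: "pos x \<le> n" using B(4)[of x] x by simp
  have xp: "x * n + pos x \<le> n * n"
    using px x mult_le_mono1[of "Suc x" n n] by simp
  have n: "n \<le> n * n" by (rule le_square)
  show ?thesis
  proof (cases "pos x = n")
    case True
    have "loop_inv pos best H E out r m x 1" using L True unfolding loop_inv_def by simp
    then show ?thesis
      using True s stop x n W B(5) score
      unfolding propose_body_def
      by (simp add: fits_def fold main_inv_def input_intact_def fuel_def)
  next
    case False
    then have p: "pos x < n" using px by simp
    define w where "w = choice x (pos x)"
    have w: "w < n" unfolding w_def using choice_less x p by blast
    have row: "rows n (mprefs I) (x * n + pos x) = w" unfolding w_def by (rule rows_choice[OF x p])
    have wx: "w * n + x < n * n" by (rule index_less[OF w x])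
    \<comment> \<open>Each completed round used a proposal of \<open>x\<close>, so
      \<open>r \<le> pos x < n\<close> and row \<open>r\<close> lies within the first
      \<open>n * n\<close> cells.\<close>
    have rx: "r * n + x < n * n" using index_less[of r n x n] B(3) p x by simp
    have rn: "r * n < n * n" using rx by linarith
    have xn: "x * n < n * n" "w * n < n * n" using x w by auto
    have bounds: "H w < n" "E w \<le> Suc r" "best w \<le> n" "r < n" "m < n" "score w x \<le> n"
      using B w p score_le by auto
    have sum: "sum (pos(x := Suc (pos x))) {..<n} = Suc (sum pos {..<n})"
      using x by (subst (1 2) sum.remove[of _ x]) auto
    have fuel: "n * n + 1 - sum (pos(x := Suc (pos x))) {..<n} < n * n + 1 - sum pos {..<n}"
      using sum B(5) by simp
    show ?thesis
    proof (cases "best w < score w x")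
      case reject: False
      then have "loop_inv (pos(x := Suc (pos x))) best H E out r m x 0"
        using loop_inv_reject[OF L p] unfolding w_def by simp
      then show ?thesis
        using p s stop x xp n W score[OF w x] score row wx xn bounds reject fuel
        unfolding propose_body_def
        by (simp add: fits_def fold main_inv_def input_intact_def fuel_def)
    next
      case accept: True
      show ?thesis
      proof (cases "E w = Suc r")
        case True
        note loop_inv_displace[OF L p w_def accept True]
        then show ?thesis
          using p s stop x xp n W score[OF w x] score row wx xn rx rn bounds accept fuel True
          unfolding propose_body_def accept_body_def
          by (simp add: fits_def fold main_inv_def input_intact_def fuel_def)
      next
        case engage: False
        note loop_inv_engage[OF L p w_def accept engage]
        then show ?thesis
          using p s stop x xp n W score[OF w x] score row wx xn rx rn bounds accept fuel engage
          unfolding propose_body_def accept_body_def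
          by (cases "Suc m = n") (simp_all add: fits_def fold main_inv_def input_intact_def fuel_def)
      qed
    qed
  qed
qed

lemma propose_loop:
  assumes init: "main_inv s" and W: "2 * (n * n) + 4 * n + 4 \<le> W"
  shows "\<exists>t s'. exec W (While propose_guard propose_body) s t s' \<and>
    t \<le> (n * n + 2) * (1 + bcost propose_guard + max_cost propose_body) \<and>
    distinct (output_matchings I s') \<and>
    largest_disjoint_stable_matchings I (set (output_matchings I s'))"
proof -
  have "\<exists>t s'. exec W (While propose_guard propose_body) s t s' \<and>
     t \<le> (fuel s + 1) * (1 + bcost propose_guard + max_cost propose_body) \<and>
     main_inv s' \<and> \<not> bval propose_guard s'"
  proof (rule while_exec[where \<mu> = fuel])
    show "fits W (bsubs propose_guard) s" if "main_inv s" for s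
      using that W unfolding propose_guard_def fits_def main_inv_def loop_inv_def by auto
  qed (use propose_body_correct W init in blast)+
  then obtain t s' where e: "exec W (While propose_guard propose_body) s t s'"
    "t \<le> (fuel s + 1) * (1 + bcost propose_guard + max_cost propose_body)"
    "main_inv s'" "\<not> bval propose_guard s'" by blast
  have "fuel s + 1 \<le> n * n + 2" unfolding fuel_def by simp
  then have t: "t \<le> (n * n + 2) * (1 + bcost propose_guard + max_cost propose_body)"
    using e(2) by (meson mult_le_mono1 order_trans)
  define x where "x = reg s' ''x''"
  have L: "loop_inv (mem s' ''pos'') (mem s' ''best'') (mem s' ''holder'') (mem s' ''round'')
      (mem s' ''out'') (reg s' ''count'') (reg s' ''m'') x (reg s' ''stop'')"
    using e(3) unfolding main_inv_def x_def by simp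
  \<comment> \<open>The loop ends only with \<open>stop\<close> equal to 1, when the unengaged
    \<open>x\<close> has exhausted his list; the unfinished row \<open>count\<close> is not
    output.\<close>
  have stop: "mem s' ''pos'' x = n"
    using L e(4) unfolding loop_inv_def propose_guard_def by auto
  have out: "output_matchings I s' =
      map (recorded_matching (mem s' ''out'')) [0..<reg s' ''count'']"
    unfolding output_matchings_def recorded_matching_def by simp
  have R: "rounds_inv (mem s' ''pos'') (mem s' ''best'') (mem s' ''holder'') (mem s' ''round'')
      (mem s' ''out'') (reg s' ''count'') ({..reg s' ''m''} - {x})"
    using L unfolding loop_inv_def by simp
  have "x \<notin> {..reg s' ''m''} - {x}" by simp
  note rounds_inv_exhausted[OF R loop_inv_bounds(1)[OF L] this stop, folded out]
  then show ?thesis using e(1) t by blast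
qed

section \<open>Input size and the whole program\<close>

lemma sum_length_eq:
  assumes "length xss = n" "\<And>i. i < n \<Longrightarrow> length (xss ! i) = n"
  shows "(\<Sum>xs\<leftarrow>xss. length xs) = n * n"
proof -
  have "map length xss = replicate n n"
    by (rule nth_equalityI) (use assms in auto)
  then show ?thesis by (simp add: sum_list_replicate)
qed

lemma input_size_eq: "input_size I = 3 * (n * n) + 2 * n"
  using sum_length_eq[of "mprefs I"] sum_length_eq[of "wprefs I"] length_mprefs length_wprefs valid
  unfolding input_size_def sm_instance_def men_def women_def by simp

text \<open>In \<open>c\<close>, ten units pay for the branching and the next term for the rank
  loop; the proposal term is doubled because \<open>n * n + 2\<close> is at most twice
  \<open>input_size I + 1\<close>.\<close>

lemma program_correct:
  defines "c \<equiv> 10 + (1 + bcost rank_guard + max_cost rank_body) +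
      2 * (1 + bcost propose_guard + max_cost propose_body)"
  shows "\<exists>t s. exec ((input_size I + 2) ^ 2) program (initial_state I) t s \<and>
    t \<le> c * (input_size I + 1) \<and> distinct (output_matchings I s) \<and>
    largest_disjoint_stable_matchings I (set (output_matchings I s))"
proof -
  let ?W = "(input_size I + 2) ^ 2"
  let ?K = "1 + bcost rank_guard + max_cost rank_body"
  let ?L = "1 + bcost propose_guard + max_cost propose_body"
  \<comment> \<open>The word range required is linear in the input size, and its factor
    \<open>2\<close> is at most \<open>input_size I + 2\<close> even when \<open>n = 0\<close>; so
    the square suffices.\<close>
  have "2 * (n * n) + 4 * n + 4 \<le> 2 * (input_size I + 2)" unfolding input_size_eq by simp
  also have "\<dots> \<le> ?W" unfolding power2_eq_square by (intro mult_right_mono) auto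
  finally have W: "2 * (n * n) + 4 * n + 4 \<le> ?W" .
  have "rank_inv (initial_state I)"
    unfolding rank_inv_def input_intact_def unused_def initial_state_def by simp
  then obtain t s where s: "exec ?W (While rank_guard rank_body) (initial_state I) t s"
    "t \<le> (n * n + 1) * ?K" "input_intact s" "unused s"
    "\<forall>w<n. \<forall>a<n. mem s ''score'' (w * n + a) = score w a"
    using rank_loop[of "initial_state I" ?W] W by auto
  have sn: "reg s ''n'' = n" using s(3) unfolding input_intact_def by simp
  let ?b = "Equal (Reg ''n'') (Const 0)"
  have fit: "fits ?W (bsubs ?b) s" using sn W unfolding fits_def by simp
  show ?thesis
  proof (cases "n = 0")
    case True
    have fit1: "fits ?W (asubs (Const 1)) s" using W unfolding fits_def by simp
    let ?s = "set_reg ''count'' (aval (Const 1) s) s"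
    have "exec ?W (com.If ?b (Assign ''count'' (Const 1)) (While propose_guard propose_body)) s
        (1 + bcost ?b + (1 + acost (Const 1))) ?s"
      using fit sn True by (intro exec.IfTrue exec.Assign fit1) auto
    then have "exec ?W program (initial_state I) (t + (1 + bcost ?b + (1 + acost (Const 1)))) ?s"
      unfolding program_def using s(1) by (rule exec.Seq[rotated])
    moreover have "t + (1 + bcost ?b + (1 + acost (Const 1))) \<le> c * (input_size I + 1)"
      using s(2) True unfolding c_def input_size_eq by simp
    moreover have out: "output_matchings I ?s = [{}]"
      unfolding output_matchings_def men_def using True by simp
    moreover have "largest_disjoint_stable_matchings I {{}}"
    proof -
      have "stable_matching I M \<longleftrightarrow> M = {}" for M
        unfolding stable_matching_def perfect_matching_def men_def women_def using True by auto
      then have "disjoint_stable_matchings I C \<longleftrightarrow> C \<subseteq> {{}}" for C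
        unfolding disjoint_stable_matchings_def pairwise_def by auto
      moreover have "card C \<le> card {{}}" if "C \<subseteq> {{}}" for C :: "(nat \<times> nat) set set"
        using card_mono[OF _ that] by simp
      ultimately show ?thesis unfolding largest_disjoint_stable_matchings_def by auto
    qed
    ultimately show ?thesis by (intro exI conjI) (assumption, assumption, simp_all)
  next
    case False
    have "main_inv s"
      unfolding main_inv_def loop_inv_def
      using s(3-5) False rounds_inv_initial unfolding unused_def by simp
    then obtain u s' where s': "exec ?W (While propose_guard propose_body) s u s'"
      "u \<le> (n * n + 2) * ?L" "distinct (output_matchings I s')"
      "largest_disjoint_stable_matchings I (set (output_matchings I s'))"
      using propose_loop W by blast
    have "exec ?W (com.If ?b (Assign ''count'' (Const 1)) (While propose_guard propose_body)) s
        (1 + bcost ?b + u) s'"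
      using fit sn False s'(1) by (intro exec.IfFalse) auto
    then have "exec ?W program (initial_state I) (t + (1 + bcost ?b + u)) s'"
      unfolding program_def using s(1) by (rule exec.Seq[rotated])
    moreover have "t + (1 + bcost ?b + u) \<le> c * (input_size I + 1)"
    proof -
      have "n * n + 1 \<le> input_size I + 1" "n * n + 2 \<le> 2 * (input_size I + 1)"
        unfolding input_size_eq by auto
      then have "t \<le> (input_size I + 1) * ?K" "u \<le> 2 * (input_size I + 1) * ?L"
        using s(2) s'(2) by (meson mult_le_mono1 order_trans)+
      moreover have "1 + bcost ?b \<le> 10 * (input_size I + 1)" by simp
      moreover have "c * (input_size I + 1) =
          10 * (input_size I + 1) + (input_size I + 1) * ?K + 2 * (input_size I + 1) * ?L"
        unfolding c_def by (simp only: algebra_simps)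
      ultimately show ?thesis by linarith
    qed
    ultimately show ?thesis using s' by blast
  qed
qed

end

theorem theorem1:
  "\<exists>(p :: com) (k :: nat) (c :: nat). \<forall>I. sm_instance I \<longrightarrow>
     (\<exists>t s. exec ((input_size I + 2) ^ k) p (initial_state I) t s \<and>
            t \<le> c * (input_size I + 1) \<and>
            distinct (output_matchings I s) \<and>
            largest_disjoint_stable_matchings I (set (output_matchings I s)))"
  using stable_marriage.program_correct[OF stable_marriage.intro] by blast

end
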